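(* Let $P$ be a finite poset. Then $$\mathfrak{Z}^{s}(P)=\sum_{n=1}^\infty(-1)^{n+1}\,\#\hom_{Poset^s}(P,\langle n\rangle)\,x^n .$$
   Context: $\langle n\rangle$ is the chain $1<2<\cdots<n$. Posets $P$ are nonempty. $\Omega^\circ(P,n)$ is the number of strict order-preserving maps $P\to\langle n\rangle$ ($x<y\Rightarrow f(x)<f(y)$); it is a polynomial in $n$, and the integers $d_{P,i}$ are defined by $\Omega^\circ(P,x)=\sum_{i=1}^{|P|}d_{P,i}\binom{x}{i}$. The weak surjective order series of $P$ is defined by $$\mathfrak{Z}^{s}(P):=\sum_{i=1}^{|P|}(-1)^{|P|-i}d_{P,i}\,x(1-x)^{i-1}.$$ $\hom_{Poset^s}(P,\langle n\rangle)$ is the set of surjective weakly order-preserving maps $P\to\langle n\rangle$ ($x\le y\Rightarrow f(x)\le f(y)$). *)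

theory Defs
  imports "HOL-Computational_Algebra.Computational_Algebra" "HOL-Library.FuncSet"
begin

text \<open>A poset is a carrier set \<open>P\<close> with a relation \<open>r\<close> such that \<^term>\<open>partial_order_on P r\<close>.
  Maps out of \<open>P\<close> are taken to be \<^const>\<open>undefined\<close> outside \<open>P\<close>, so that they can be counted.
  The chain with \<open>n\<close> elements is \<open>{1..n}\<close>.\<close>

definition strict_homs :: "'a set \<Rightarrow> 'a rel \<Rightarrow> nat \<Rightarrow> ('a \<Rightarrow> nat) set" where
  "strict_homs P r n =
     {f \<in> P \<rightarrow>\<^sub>E {1..n}. monotone_on P (\<lambda>x y. (x, y) \<in> r \<and> x \<noteq> y) (<) f}"

definition weak_surj_homs :: "'a set \<Rightarrow> 'a rel \<Rightarrow> nat \<Rightarrow> ('a \<Rightarrow> nat) set" where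
  "weak_surj_homs P r n =
     {f \<in> P \<rightarrow>\<^sub>E {1..n}. monotone_on P (\<lambda>x y. (x, y) \<in> r) (\<le>) f \<and> f ` P = {1..n}}"

definition strict_order_poly :: "'a set \<Rightarrow> 'a rel \<Rightarrow> rat poly" where
  "strict_order_poly P r = (THE p. \<forall>n. poly p (of_nat n) = of_nat (card (strict_homs P r n)))"

text \<open>The integers \<open>d\<^sub>P\<^sub>,\<^sub>i\<close>, set to \<open>0\<close> outside the range \<open>1 \<le> i \<le> |P|\<close>; existence and uniqueness
  are shown in \<open>ex1_strict_order_poly\<close> and \<open>ex1_order_coeff\<close> below.\<close>

definition order_coeff :: "'a set \<Rightarrow> 'a rel \<Rightarrow> nat \<Rightarrow> int" where
  "order_coeff P r = (THE d. (\<forall>i. i \<notin> {1..card P} \<longrightarrow> d i = 0) \<and>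
     (\<forall>x. poly (strict_order_poly P r) x = (\<Sum>i = 1..card P. of_int (d i) * (x gchoose i))))"

definition weak_surj_series :: "'a set \<Rightarrow> 'a rel \<Rightarrow> int fps" where
  "weak_surj_series P r =
     (\<Sum>i = 1..card P. fps_const ((-1) ^ (card P - i) * order_coeff P r i)
        * (fps_X * (1 - fps_X) ^ (i - 1)))"


subsection \<open>The order polynomial and its coefficients are well defined\<close>

definition strict_onto :: "'a set \<Rightarrow> 'a rel \<Rightarrow> nat set \<Rightarrow> ('a \<Rightarrow> nat) set" where
  "strict_onto P r S =
     {f \<in> extensional P. monotone_on P (\<lambda>x y. (x, y) \<in> r \<and> x \<noteq> y) (<) f \<and> f ` P = S}"

lemma bij_betw_strict_onto:
  assumes "bij_betw h T S" "strict_mono_on T h"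
  shows "bij_betw (\<lambda>f. restrict (h \<circ> f) P) (strict_onto P r T) (strict_onto P r S)"
proof (rule bij_betw_byWitness[where f' = "\<lambda>g. restrict (inv_into T h \<circ> g) P"])
  have inj: "inj_on h T" and S: "h ` T = S" using assms(1) by (auto simp: bij_betw_def)
  show "\<forall>f\<in>strict_onto P r T. restrict (inv_into T h \<circ> restrict (h \<circ> f) P) P = f"
    using inj by (auto simp: strict_onto_def fun_eq_iff restrict_def extensional_def)
  show "\<forall>g\<in>strict_onto P r S. restrict (h \<circ> restrict (inv_into T h \<circ> g) P) P = g"
  proof (intro ballI ext)
    fix g x assume g: "g \<in> strict_onto P r S"
    show "restrict (h \<circ> restrict (inv_into T h \<circ> g) P) P x = g x"
    proof (cases "x \<in> P")
      case True
      with g S have "g x \<in> h ` T" by (auto simp: strict_onto_def)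
      with True show ?thesis by (simp add: f_inv_into_f)
    qed (use g in \<open>auto simp: strict_onto_def extensional_def\<close>)
  qed
  show "(\<lambda>f. restrict (h \<circ> f) P) ` strict_onto P r T \<subseteq> strict_onto P r S"
  proof (intro image_subsetI)
    fix f assume f: "f \<in> strict_onto P r T"
    then have "restrict (h \<circ> f) P ` P = h ` (f ` P)" by (simp add: image_comp)
    with f S have "restrict (h \<circ> f) P ` P = S" by (simp add: strict_onto_def)
    with f assms(2) show "restrict (h \<circ> f) P \<in> strict_onto P r S"
      by (auto simp: strict_onto_def monotone_on_def)
  qed
  have "inv_into T h x < inv_into T h y" if "x \<in> S" "y \<in> S" "x < y" for x y
  proof -
    have "strict_mono_on T h" by fact
    then have "\<not> inv_into T h y \<le> inv_into T h x"
      using that S inv_into_into[of x h T] inv_into_into[of y h T]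
      by (metis f_inv_into_f less_imp_not_less not_less_iff_gr_or_eq order_le_less strict_mono_onD)
    then show ?thesis by simp
  qed
  note mono = this
  have inv: "inv_into T h ` S = T" using inj S by force
  show "(\<lambda>g. restrict (inv_into T h \<circ> g) P) ` strict_onto P r S \<subseteq> strict_onto P r T"
  proof (intro image_subsetI)
    fix g assume g: "g \<in> strict_onto P r S"
    then have "restrict (inv_into T h \<circ> g) P ` P = inv_into T h ` (g ` P)" by (simp add: image_comp)
    with g inv have "restrict (inv_into T h \<circ> g) P ` P = T" by (simp add: strict_onto_def)
    with g mono show "restrict (inv_into T h \<circ> g) P \<in> strict_onto P r T"
      by (auto simp: strict_onto_def monotone_on_def)
  qed
qed

lemma card_strict_onto:
  assumes "finite S"
  shows "card (strict_onto P r S) = card (strict_onto P r {..<card S})"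
proof -
  obtain h where "bij_betw h {..<card S} S" "strict_mono_on {..<card S} h"
    using ex_bij_betw_strict_mono_card[OF assms] .
  from bij_betw_same_card[OF bij_betw_strict_onto[OF this]] show ?thesis by metis
qed

lemma card_strict_homs:
  assumes "finite P" "P \<noteq> {}"
  shows "card (strict_homs P r n) =
    (\<Sum>i = 1..card P. card (strict_onto P r {..<i}) * (n choose i))"
proof -
  let ?s = "\<lambda>i. card (strict_onto P r {..<i})"
  have fin: "finite (strict_homs P r n)"
    unfolding strict_homs_def using assms by (simp add: finite_PiE)
  have eq: "strict_homs P r n = (\<Union>S\<in>Pow {1..n}. strict_onto P r S)"
    by (auto simp: strict_homs_def strict_onto_def PiE_def Pi_def)
  have "card (strict_homs P r n) = (\<Sum>S\<in>Pow {1..n}. card (strict_onto P r S))"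
    unfolding eq
  proof (rule card_UN_disjoint)
    show "\<forall>S\<in>Pow {1..n}. finite (strict_onto P r S)"
      using fin unfolding eq by (auto intro: rev_finite_subset)
    show "\<forall>S\<in>Pow {1..n}. \<forall>T\<in>Pow {1..n}. S \<noteq> T \<longrightarrow> strict_onto P r S \<inter> strict_onto P r T = {}"
      by (auto simp: strict_onto_def)
  qed simp
  also have "\<dots> = (\<Sum>S\<in>Pow {1..n}. ?s (card S))"
    by (intro sum.cong refl card_strict_onto) (auto intro: finite_subset)
  also have "\<dots> = (\<Sum>i = 0..n. \<Sum>S | S \<in> Pow {1..n} \<and> card S = i. ?s (card S))"
    by (intro sum.group[symmetric]) (auto simp: card_mono[of "{1..n}", simplified])
  also have "\<dots> = (\<Sum>i = 0..n. ?s i * (n choose i))"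
    using n_subsets[of "{1..n}"] by (intro sum.cong) auto
  also have "\<dots> = (\<Sum>i = 0..n + card P. ?s i * (n choose i))"
    by (intro sum.mono_neutral_left) auto
  also have "\<dots> = (\<Sum>i = 1..card P. ?s i * (n choose i))"
  proof (intro sum.mono_neutral_right ballI)
    fix i assume i: "i \<in> {0..n + card P} - {1..card P}"
    have "strict_onto P r {..<i} = {}"
    proof (rule ccontr)
      assume "strict_onto P r {..<i} \<noteq> {}"
      then obtain f where "f ` P = {..<i}" by (auto simp: strict_onto_def)
      with assms card_image_le[OF assms(1), of f] have "i \<le> card P" "i \<noteq> 0" by auto
      with i show False by auto
    qed
    then show "?s i * (n choose i) = 0" by simp
  qed auto
  finally show ?thesis .
qed

lemma poly_gbinomial_sum:
  "\<exists>p :: rat poly. \<forall>x. poly p x = (\<Sum>i\<in>A. c i * (x gchoose i))"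
proof
  show "\<forall>x. poly (\<Sum>i\<in>A. smult (c i / fact i) (\<Prod>j = 0..<i. [:- of_nat j, 1:])) x
    = (\<Sum>i\<in>A. c i * (x gchoose i))"
    by (auto simp: poly_sum poly_prod gbinomial_prod_rev intro!: sum.cong prod.cong)
qed

lemma poly_eq_of_nat:
  fixes p q :: "rat poly"
  assumes "\<And>n. poly p (of_nat n) = poly q (of_nat n)"
  shows "p = q"
proof (rule ccontr)
  assume "p \<noteq> q"
  then have "finite {x. poly (p - q) x = 0}" by (intro poly_roots_finite) simp
  moreover have "range of_nat \<subseteq> {x. poly (p - q) x = 0}" using assms by auto
  ultimately have "finite (range (of_nat :: nat \<Rightarrow> rat))" by (rule rev_finite_subset)
  then show False by (simp add: finite_image_iff inj_on_def)
qed

lemma ex1_strict_order_poly: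
  assumes "finite P" "P \<noteq> {}"
  shows "\<exists>!p :: rat poly. \<forall>n. poly p (of_nat n) = of_nat (card (strict_homs P r n))"
proof (rule ex_ex1I)
  obtain p :: "rat poly" where "\<And>x. poly p x =
      (\<Sum>i = 1..card P. of_nat (card (strict_onto P r {..<i})) * (x gchoose i))"
    using poly_gbinomial_sum[where A = "{1..card P}" and c = "\<lambda>i. of_nat (card (strict_onto P r {..<i}))"]
    by blast
  then have "\<forall>n. poly p (of_nat n) = of_nat (card (strict_homs P r n))"
    by (simp add: card_strict_homs[OF assms] binomial_gbinomial)
  then show "\<exists>p :: rat poly. \<forall>n. poly p (of_nat n) = of_nat (card (strict_homs P r n))" by blast
qed (auto intro: poly_eq_of_nat)

lemmas poly_strict_order_poly =
  theI'[OF ex1_strict_order_poly, folded strict_order_poly_def, rule_format]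

lemma ex1_order_coeff:
  assumes "finite P" "P \<noteq> {}"
  shows "\<exists>!d :: nat \<Rightarrow> int. (\<forall>i. i \<notin> {1..card P} \<longrightarrow> d i = 0) \<and>
    (\<forall>x. poly (strict_order_poly P r) x = (\<Sum>i = 1..card P. of_int (d i) * (x gchoose i)))"
    (is "\<exists>!d. ?Q d")
proof (rule ex_ex1I)
  let ?d = "\<lambda>i. if i \<in> {1..card P} then int (card (strict_onto P r {..<i})) else 0"
  obtain p :: "rat poly" where p: "\<And>x. poly p x =
      (\<Sum>i = 1..card P. of_int (?d i) * (x gchoose i))"
    using poly_gbinomial_sum[where A = "{1..card P}" and c = "\<lambda>i. of_int (?d i)"] by blast
  have "strict_order_poly P r = p"
    by (rule poly_eq_of_nat)
      (simp add: poly_strict_order_poly[OF assms] p card_strict_homs[OF assms] binomial_gbinomial)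
  with p have "?Q ?d" by simp
  then show "\<exists>d. ?Q d" by (rule exI[of _ ?d])
next
  fix d e assume d: "?Q d" and e: "?Q e"
  have "d i = e i" for i
  proof (induction i rule: less_induct)
    case (less i)
    show ?case
    proof (cases "i \<in> {1..card P}")
      case True
      have split: "(\<Sum>j = 1..card P. rat_of_int (c j) * (of_nat i gchoose j)) =
        of_int (c i) + (\<Sum>j = 1..<i. of_int (c j) * (of_nat i gchoose j))" for c
      proof -
        have "(\<Sum>j = 1..card P. rat_of_int (c j) * (of_nat i gchoose j)) =
          (\<Sum>j = 1..i. rat_of_int (c j) * (of_nat i gchoose j))"
          using True by (intro sum.mono_neutral_right) (auto simp: binomial_gbinomial[symmetric])
        also have "{1..i} = insert i {1..<i}" using True by auto
        finally show ?thesis by (simp add: binomial_gbinomial[symmetric])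
      qed
      have "(\<Sum>j = 1..card P. rat_of_int (d j) * (of_nat i gchoose j)) =
        (\<Sum>j = 1..card P. rat_of_int (e j) * (of_nat i gchoose j))"
        using d e by metis
      with less show ?thesis unfolding split by simp
    qed (use d e in auto)
  qed
  then show "d = e" by blast
qed

end

(* For every nonempty poset the numbers s_i of strict surjections onto chains satisfy
     s_1 - s_2 + s_3 - ... = (-1)^(|P| + 1).
   The fibres of a weak surjection P -> <n> are n nonempty posets, so applying this identity to each
   fibre writes the number of weak surjections as a signed count of pairs of a strict surjection
   P -> <i> and a weak surjection <i> -> <n>; of the latter there are (i - 1 choose n - 1).
   That binomial coefficient is, up to sign, the coefficient of x^n in x (1 - x)^(i - 1). *)

theory Submission
  imports Defs
begin

section \<open>Splitting monotone surjections along the codomain\<close>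

text \<open>Generic in both relations, so that one splitting result serves strict and weak maps, and
  with an arbitrary image \<open>S\<close>, so that pieces of a chain can serve as
  codomains.\<close>

definition monotone_onto ::
    "'a set \<Rightarrow> ('a \<Rightarrow> 'a \<Rightarrow> bool) \<Rightarrow> ('b \<Rightarrow> 'b \<Rightarrow> bool) \<Rightarrow> 'b set \<Rightarrow> ('a \<Rightarrow> 'b) set" where
  "monotone_onto P Q ord S = {f \<in> extensional P. monotone_on P Q ord f \<and> f ` P = S}"

definition down_sets :: "'a set \<Rightarrow> ('a \<Rightarrow> 'a \<Rightarrow> bool) \<Rightarrow> 'a set set" where
  "down_sets P Q = {D. D \<subseteq> P \<and> (\<forall>x\<in>D. \<forall>y\<in>P - D. \<not> Q y x)}"

lemma finite_down_sets: "finite P \<Longrightarrow> finite (down_sets P Q)"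
  by (rule finite_subset[of _ "Pow P"]) (auto simp: down_sets_def)

lemma finite_monotone_onto:
  assumes "finite P"
  shows "finite (monotone_onto P Q ord S)"
proof (cases "finite S")
  case True
  have "monotone_onto P Q ord S \<subseteq> P \<rightarrow>\<^sub>E S"
    by (auto simp: monotone_onto_def PiE_def)
  with True assms show ?thesis by (meson finite_PiE finite_subset)
next
  case False
  with assms have "monotone_onto P Q ord S = {}" by (auto simp: monotone_onto_def)
  then show ?thesis by simp
qed

text \<open>When every value in \<open>A\<close> lies strictly below every value in
  \<open>B\<close>, the preimage of \<open>A\<close> is closed downwards. Conversely, maps on a
  down-set and on its complement glue, since \<open>cross\<close> handles the related pairs that
  straddle the two.\<close>

lemma bij_betw_monotone_onto_Un:
  assumes cross: "\<And>a b. a \<in> A \<Longrightarrow> b \<in> B \<Longrightarrow> ord a b \<and> \<not> ord b a"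
  shows "bij_betw (\<lambda>f. ({x \<in> P. f x \<in> A}, restrict f {x \<in> P. f x \<in> A}, restrict f {x \<in> P. f x \<notin> A}))
    (monotone_onto P Q ord (A \<union> B))
    (SIGMA D : down_sets P Q. monotone_onto D Q ord A \<times> monotone_onto (P - D) Q ord B)"
    (is "bij_betw ?f ?M ?N")
\<comment> \<open>Outside \<open>P\<close> the glued map follows \<open>h\<close>, which is
  \<open>undefined\<close> there, so it is again extensional.\<close>
proof (rule bij_betw_byWitness[where f' = "\<lambda>(D, g, h) x. if x \<in> D then g x else h x"])
  have disj: "A \<inter> B = {}" using cross by blast
  show "\<forall>f\<in>?M. (case ?f f of (D, g, h) \<Rightarrow> \<lambda>x. if x \<in> D then g x else h x) = f"
    by (auto simp: monotone_onto_def fun_eq_iff extensional_def)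
  show "?f ` ?M \<subseteq> ?N"
  proof (intro image_subsetI)
    fix f assume "f \<in> ?M"
    then have mono: "\<And>x y. x \<in> P \<Longrightarrow> y \<in> P \<Longrightarrow> Q x y \<Longrightarrow> ord (f x) (f y)" and im: "f ` P = A \<union> B"
      by (auto simp: monotone_onto_def monotone_on_def)
    let ?D = "{x \<in> P. f x \<in> A}"
    have PD: "P - ?D = {x \<in> P. f x \<notin> A}" by auto
    have "f x \<in> B" if "x \<in> P" "f x \<notin> A" for x using im that by blast
    then have "?D \<in> down_sets P Q" using mono cross by (fastforce simp: down_sets_def)
    moreover have "restrict f ?D \<in> monotone_onto ?D Q ord A"
      using mono im by (auto simp: monotone_onto_def monotone_on_def)
    moreover have "f ` {x \<in> P. f x \<notin> A} = f ` P - A" by auto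
    then have "f ` {x \<in> P. f x \<notin> A} = B" using im disj by auto
    then have "restrict f {x \<in> P. f x \<notin> A} \<in> monotone_onto (P - ?D) Q ord B"
      unfolding PD using mono by (auto simp: monotone_onto_def monotone_on_def)
    ultimately show "?f f \<in> ?N" by auto
  qed
  have inv: "(\<lambda>x. if x \<in> D then g x else h x) \<in> ?M \<and>
      ?f (\<lambda>x. if x \<in> D then g x else h x) = (D, g, h)"
    if D: "D \<in> down_sets P Q" and g: "g \<in> monotone_onto D Q ord A"
      and h: "h \<in> monotone_onto (P - D) Q ord B" for D g h
  proof -
    let ?u = "\<lambda>x. if x \<in> D then g x else h x"
    have sub: "D \<subseteq> P" using D by (auto simp: down_sets_def)
    have gA: "g ` D = A" and hB: "h ` (P - D) = B" using g h by (auto simp: monotone_onto_def)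
    have "?u ` P = ?u ` D \<union> ?u ` (P - D)" using sub by blast
    also have "\<dots> = A \<union> B" using gA hB by auto
    finally have im: "?u ` P = A \<union> B" .
    have "monotone_on P Q ord ?u"
      unfolding monotone_on_def
    proof (intro ballI impI)
      fix x y assume xy: "x \<in> P" "y \<in> P" "Q x y"
      \<comment> \<open>The remaining case, \<open>x\<close> outside \<open>D\<close> and
        \<open>y\<close> inside, is what a down-set excludes.\<close>
      consider "x \<in> D" "y \<in> D" | "x \<in> D" "y \<in> P - D" | "x \<in> P - D" "y \<in> P - D"
        using D xy by (auto simp: down_sets_def)
      then show "ord (?u x) (?u y)"
      proof cases
        case 1 then show ?thesis using g xy by (auto simp: monotone_onto_def monotone_on_def)
      next
        case 2 then show ?thesis using gA hB cross[of "g x" "h y"] by auto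
      next
        case 3 then show ?thesis using h xy by (auto simp: monotone_onto_def monotone_on_def)
      qed
    qed
    moreover have "?u \<in> extensional P"
      using h sub by (auto simp: monotone_onto_def extensional_def)
    ultimately have "?u \<in> ?M" using im by (simp add: monotone_onto_def)
    moreover have "?u x \<in> A \<longleftrightarrow> x \<in> D" if "x \<in> P" for x
      using gA hB disj that by auto
    then have "{x \<in> P. ?u x \<in> A} = D" "{x \<in> P. ?u x \<notin> A} = P - D" using sub by blast+
    moreover have "restrict ?u D = g" "restrict ?u (P - D) = h"
      using g h by (auto simp: monotone_onto_def extensional_def fun_eq_iff)
    ultimately show ?thesis by simp
  qed
  show "\<forall>t\<in>?N. ?f (case t of (D, g, h) \<Rightarrow> \<lambda>x. if x \<in> D then g x else h x) = t"
  proof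
    fix t assume "t \<in> ?N"
    then obtain D g h where "t = (D, g, h)" "D \<in> down_sets P Q"
      "g \<in> monotone_onto D Q ord A" "h \<in> monotone_onto (P - D) Q ord B" by auto
    with inv[of D g h] show "?f (case t of (D, g, h) \<Rightarrow> \<lambda>x. if x \<in> D then g x else h x) = t"
      by (simp only: prod.case)
  qed
  show "(\<lambda>(D, g, h) x. if x \<in> D then g x else h x) ` ?N \<subseteq> ?M"
    using conjunct1[OF inv] by auto
qed

lemma card_monotone_onto_Un:
  assumes "finite P" "\<And>a b. a \<in> A \<Longrightarrow> b \<in> B \<Longrightarrow> ord a b \<and> \<not> ord b a"
  shows "card (monotone_onto P Q ord (A \<union> B)) =
    (\<Sum>D\<in>down_sets P Q. card (monotone_onto D Q ord A) * card (monotone_onto (P - D) Q ord B))"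
proof -
  have "finite D" if "D \<in> down_sets P Q" for D
    using that assms(1) by (auto simp: down_sets_def intro: finite_subset)
  then show ?thesis
    using assms(1) bij_betw_same_card[OF bij_betw_monotone_onto_Un[where P = P and Q = Q, OF assms(2)]]
    by (simp add: finite_down_sets finite_monotone_onto card_cartesian_product)
qed

abbreviation ideals :: "'a set \<Rightarrow> 'a rel \<Rightarrow> 'a set set" where
  "ideals P r \<equiv> down_sets P (\<lambda>x y. (x, y) \<in> r)"

lemma strict_onto_eq: "strict_onto P r S = monotone_onto P (\<lambda>x y. (x, y) \<in> r \<and> x \<noteq> y) (<) S"
  by (simp add: strict_onto_def monotone_onto_def)

text \<open>A point of \<open>D\<close> and a point outside it are distinct anyway. Strict and weak
  splittings therefore range over the same index set, which makes the two recursions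
  comparable.\<close>

lemma down_sets_strict: "down_sets P (\<lambda>x y. (x, y) \<in> r \<and> x \<noteq> y) = ideals P r"
  by (auto simp: down_sets_def)


section \<open>Strict surjections\<close>

text \<open>Cut the chain after its first \<open>k\<close> levels; the upper block can be moved back
  to \<open>{..<l}\<close> because the count depends only on the size of the codomain.\<close>

lemma card_strict_onto_add:
  assumes "finite P"
  shows "card (strict_onto P r {..<k + l}) =
    (\<Sum>D\<in>ideals P r. card (strict_onto D r {..<k}) * card (strict_onto (P - D) r {..<l}))"
proof -
  have "{..<k + l} = {..<k} \<union> {k..<k + l}" by auto
  then have "card (strict_onto P r {..<k + l}) =
      (\<Sum>D\<in>ideals P r. card (strict_onto D r {..<k}) * card (strict_onto (P - D) r {k..<k + l}))"
    unfolding strict_onto_eq using assms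
    by (simp only:, subst card_monotone_onto_Un) (auto simp: down_sets_strict)
  then show ?thesis by (simp add: card_strict_onto[of "{k..<k + l}"])
qed

section \<open>Extreme cases: no points, too many levels, one level\<close>

lemma card_strict_onto_empty [simp]: "card (strict_onto {} r {}) = 1"
  by (simp add: strict_onto_def monotone_on_def)

lemma strict_onto_empty: "P \<noteq> {} \<Longrightarrow> strict_onto P r {} = {}"
  by (auto simp: strict_onto_def)

lemma strict_onto_eq_empty:
  assumes "finite P" "card P < i"
  shows "strict_onto P r {..<i} = {}"
proof (rule ccontr)
  assume "strict_onto P r {..<i} \<noteq> {}"
  then obtain f where "f ` P = {..<i}" by (auto simp: strict_onto_def)
  with card_image_le[OF assms(1), of f] assms(2) show False by simp
qed

text \<open>The constant map is the only candidate, and it is strict exactly on antichains.\<close>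

lemma card_strict_onto_1:
  "card (strict_onto P r {..<Suc 0}) =
    (if P \<noteq> {} \<and> (\<forall>x\<in>P. \<forall>y\<in>P. (x, y) \<in> r \<longrightarrow> x = y) then 1 else 0)"
proof -
  have sub: "strict_onto P r {..<Suc 0} \<subseteq> {\<lambda>x\<in>P. 0}"
  proof
    fix f assume "f \<in> strict_onto P r {..<Suc 0}"
    then have "f \<in> extensional P" "\<And>x. x \<in> P \<Longrightarrow> f x \<in> {..<Suc 0}"
      unfolding strict_onto_def by blast+
    then show "f \<in> {\<lambda>x\<in>P. 0}" by (auto simp: fun_eq_iff extensional_def)
  qed
  show ?thesis
  proof (cases "P \<noteq> {} \<and> (\<forall>x\<in>P. \<forall>y\<in>P. (x, y) \<in> r \<longrightarrow> x = y)")
    case True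
    then have "(\<lambda>x\<in>P. 0) \<in> strict_onto P r {..<Suc 0}"
      by (auto simp: strict_onto_def monotone_on_def lessThan_Suc)
    with sub have "strict_onto P r {..<Suc 0} = {\<lambda>x\<in>P. 0}" by blast
    with True show ?thesis by simp
  next
    case False
    then have "(\<lambda>x\<in>P. 0) \<notin> strict_onto P r {..<Suc 0}"
      by (auto simp: strict_onto_def monotone_on_def)
    with sub have "strict_onto P r {..<Suc 0} = {}" by blast
    with False show ?thesis by simp
  qed
qed

section \<open>The alternating sum of the strict surjection counts\<close>

definition min_elems :: "'a set \<Rightarrow> 'a rel \<Rightarrow> 'a set" where
  "min_elems P r = {x \<in> P. \<forall>y\<in>P. (y, x) \<in> r \<longrightarrow> y = x}"

lemma min_elems_nonempty:
  assumes "finite P" "P \<noteq> {}" "trans r" "antisym r"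
  shows "min_elems P r \<noteq> {}"
proof -
  let ?R = "\<lambda>x y. (x, y) \<in> r \<and> x \<noteq> y"
  have "\<exists>m\<in>P. \<forall>x\<in>P. x \<noteq> m \<longrightarrow> \<not> ?R x m"
  proof (rule Finite_Set.bex_min_element[OF assms(1)])
    show "transp_on P ?R"
      using assms(3,4) by (auto intro!: transp_onI dest: transD antisymD)
    show "asymp_on P ?R"
      using assms(4) by (auto intro!: asymp_onI dest: antisymD)
  qed fact
  then show ?thesis by (auto simp: min_elems_def)
qed

text \<open>Expand the product of the factors \<open>- 1 + 1\<close> over \<open>A\<close>.\<close>

lemma sum_Pow_alternating:
  assumes "finite A" "A \<noteq> {}"
  shows "(\<Sum>X\<in>Pow A. (- 1 :: int) ^ card X) = 0"
  using prod_add[OF assms(1), of "\<lambda>_. - 1 :: int" "\<lambda>_. 1"] assms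
  by (simp add: power_0_left)

text \<open>Allows one summation bound, \<open>card P\<close>, for all the smaller posets
  \<open>P - D\<close> in the induction below.\<close>

lemma sum_strict_onto_extend:
  assumes "finite P" "card P < N"
  shows "(\<Sum>i<N. int (card (strict_onto P r {..<i})) * c i) =
    (\<Sum>i\<le>card P. int (card (strict_onto P r {..<i})) * c i)"
  using assms by (intro sum.mono_neutral_right) (auto simp: strict_onto_eq_empty)

text \<open>The lowest level of a strict surjection is an arbitrary nonempty set of minimal elements.
  Splitting it off reduces the claim to the vanishing alternating sum over the subsets of
  \<^term>\<open>min_elems P r\<close>.\<close>

lemma alternating_sum_strict_onto:
  assumes "finite P" "trans r" "antisym r"
  shows "(\<Sum>i\<le>card P. int (card (strict_onto P r {..<i})) * (- 1) ^ i) = (- 1) ^ card P"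
  using assms(1)
proof (induction rule: finite_psubset_induct)
  case (psubset P)
  let ?s = "\<lambda>P i. int (card (strict_onto P r {..<i}))"
  let ?M = "min_elems P r"
  show ?case
  proof (cases "P = {}")
    case False
    have M: "finite ?M" using psubset.hyps by (simp add: min_elems_def)
    have level: "?s D 1 = of_bool (D \<in> Pow ?M - {{}})" if "D \<in> ideals P r" for D
    proof -
      \<comment> \<open>In a down-set, an element minimal in \<open>D\<close> is minimal in
        \<open>P\<close>, so the antichains among the down-sets are the sets of minimal
        elements.\<close>
      have "D \<subseteq> ?M \<longleftrightarrow> (\<forall>x\<in>D. \<forall>y\<in>D. (x, y) \<in> r \<longrightarrow> x = y)"
        using that unfolding down_sets_def min_elems_def by blast
      then show ?thesis by (auto simp: card_strict_onto_1)
    qed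
    \<comment> \<open>The induction hypothesis covers \<open>P - D\<close> only for nonempty
      \<open>D\<close>; for empty \<open>D\<close> the factor \<open>?s D 1\<close>
      vanishes.\<close>
    have rest: "?s D 1 * (\<Sum>i<card P. ?s (P - D) i * (- 1) ^ i) =
        (- 1) ^ card P * (?s D 1 * (- 1) ^ card D)" if D: "D \<in> ideals P r" for D
    proof (cases "D = {}")
      case True
      with level[OF D] show ?thesis by simp
    next
      case False
      have sub: "D \<subseteq> P" using D by (simp add: down_sets_def)
      then have PD: "P - D \<subset> P" "finite (P - D)" using False psubset.hyps by auto
      then have "(\<Sum>i<card P. ?s (P - D) i * (- 1) ^ i) = (- 1) ^ card (P - D)"
        using psubset by (simp add: sum_strict_onto_extend psubset_card_mono)
      moreover have "card P = card (P - D) + card D"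
        using sub psubset.hyps by (metis card_Diff_subset card_mono finite_subset le_add_diff_inverse2)
      ultimately show ?thesis by (simp add: power_add algebra_simps flip: power_mult_distrib)
    qed
    \<comment> \<open>The term \<open>i = 0\<close> drops out because \<open>P\<close> is nonempty;
      the others have a lowest level to split off.\<close>
    have "(\<Sum>i\<le>card P. ?s P i * (- 1) ^ i) = (\<Sum>i<card P. ?s P (1 + i) * (- 1) ^ Suc i)"
      using False by (simp add: sum.atMost_shift strict_onto_empty)
    also have "\<dots> = - (\<Sum>D\<in>ideals P r. ?s D 1 * (\<Sum>i<card P. ?s (P - D) i * (- 1) ^ i))"
      unfolding card_strict_onto_add[OF psubset.hyps]
      by (simp add: sum_distrib_left sum_distrib_right sum_negf mult.assoc, subst sum.swap) simp
    also have "\<dots> = - (\<Sum>D\<in>ideals P r. (- 1) ^ card P * (?s D 1 * (- 1) ^ card D))"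
      using rest by (simp only: cong: sum.cong)
    also have "\<dots> = - ((- 1) ^ card P * (\<Sum>D\<in>ideals P r. ?s D 1 * (- 1) ^ card D))"
      by (simp add: sum_distrib_left)
    also have "(\<Sum>D\<in>ideals P r. ?s D 1 * (- 1) ^ card D) = (\<Sum>D\<in>Pow ?M - {{}}. (- 1) ^ card D)"
    proof (rule sum.mono_neutral_cong_right)
      show "finite (ideals P r)" using psubset.hyps by (rule finite_down_sets)
      show sub: "Pow ?M - {{}} \<subseteq> ideals P r"
        unfolding down_sets_def min_elems_def by blast
      show "\<forall>D\<in>ideals P r - (Pow ?M - {{}}). ?s D 1 * (- 1) ^ card D = 0"
      proof
        fix D assume "D \<in> ideals P r - (Pow ?M - {{}})"
        then show "?s D 1 * (- 1) ^ card D = 0" using level[of D] by simp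
      qed
      show "?s D 1 * (- 1) ^ card D = (- 1) ^ card D" if "D \<in> Pow ?M - {{}}" for D
        using level[of D] subsetD[OF sub that] that by simp
    qed
    \<comment> \<open>The sum over all subsets is \<open>0\<close>, and the omitted empty set
      contributes \<open>1\<close>.\<close>
    also have "\<dots> = - 1"
      using sum_Pow_alternating[OF M] min_elems_nonempty[OF psubset.hyps False assms(2,3)] M
      by (simp add: sum_diff1)
    finally show ?thesis by simp
  qed simp
qed

section \<open>Weak surjections\<close>

text \<open>The index is shifted: \<open>weak_count P r n\<close> is the number of weak surjections onto \<open>n + 1\<close> points.\<close>

definition weak_count :: "'a set \<Rightarrow> 'a rel \<Rightarrow> nat \<Rightarrow> int" where
  "weak_count P r n = (\<Sum>i<card P. (- 1) ^ (card P + Suc i) *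
     int (card (strict_onto P r {..<Suc i})) * int (i choose n))"

text \<open>All binomials are \<open>1\<close> here, so up to a global sign this is the alternating
  sum.\<close>

lemma weak_count_0:
  assumes "finite P" "trans r" "antisym r"
  shows "weak_count P r 0 = of_bool (P \<noteq> {})"
proof (cases "P = {}")
  case False
  have "weak_count P r 0 =
      (- 1) ^ card P * (\<Sum>i<card P. int (card (strict_onto P r {..<Suc i})) * (- 1) ^ Suc i)"
    by (simp add: weak_count_def power_add sum_distrib_left mult_ac)
  also have "\<dots> = (- 1) ^ card P * (\<Sum>i\<le>card P. int (card (strict_onto P r {..<i})) * (- 1) ^ i)"
    using False by (simp add: sum.atMost_shift strict_onto_empty)
  also have "\<dots> = 1"
    by (simp add: alternating_sum_strict_onto[OF assms] flip: power_mult_distrib)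
  finally show ?thesis using False by simp
qed (simp add: weak_count_def)

text \<open>This is the recursion that weak surjections obey when their lowest fibre
  \<open>D\<close> is split off. The hockey-stick identity turns the binomial into a sum over
  \<open>j\<close>, and each \<open>j\<close> prescribes where to cut the strict levels.\<close>

lemma weak_count_Suc:
  assumes "finite P"
  shows "weak_count P r (Suc n) = (\<Sum>D\<in>ideals P r. weak_count D r 0 * weak_count (P - D) r n)"
proof -
  let ?s = "\<lambda>P i. int (card (strict_onto P r {..<i}))"
  let ?g = "\<lambda>D k j. (- 1) ^ (card D + Suc k) * ?s D (Suc k) *
    ((- 1) ^ (card (P - D) + Suc j) * ?s (P - D) (Suc j) * int (j choose n))"
  have summand: "(- 1) ^ (card P + Suc (Suc m)) * ?s P (Suc (Suc m)) * int (Suc m choose Suc n) =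
      (\<Sum>D\<in>ideals P r. \<Sum>j\<le>m. ?g D (m - j) j)" for m
  proof -
    have "(- 1) ^ (card P + Suc (Suc m)) * ?s P (Suc (Suc m)) * int (j choose n) =
        (\<Sum>D\<in>ideals P r. ?g D (m - j) j)" if "j \<le> m" for j
    proof -
      \<comment> \<open>The cut gives \<open>m - j + 1\<close> levels to \<open>D\<close> and
        \<open>j + 1\<close> levels to \<open>P - D\<close>, so both parts get at least one.\<close>
      have "Suc (Suc m) = Suc (m - j) + Suc j" using that by simp
      then have "?s P (Suc (Suc m)) = (\<Sum>D\<in>ideals P r. ?s D (Suc (m - j)) * ?s (P - D) (Suc j))"
        by (simp only: card_strict_onto_add[OF assms] of_nat_sum of_nat_mult)
      moreover have "(- 1 :: int) ^ (card P + Suc (Suc m)) =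
          (- 1) ^ (card D + Suc (m - j)) * (- 1) ^ (card (P - D) + Suc j)" if "D \<in> ideals P r" for D
      proof -
        have "card P = card D + card (P - D)"
          using that assms by (metis (no_types, lifting) card_Diff_subset card_mono down_sets_def
              finite_subset le_add_diff_inverse mem_Collect_eq)
        then show ?thesis using \<open>j \<le> m\<close> by (simp add: add_ac flip: power_add)
      qed
      ultimately show ?thesis
        by (simp only: sum_distrib_left sum_distrib_right) (intro sum.cong refl, simp)
    qed
    then have "(\<Sum>j\<le>m. (- 1) ^ (card P + Suc (Suc m)) * ?s P (Suc (Suc m)) * int (j choose n)) =
        (\<Sum>D\<in>ideals P r. \<Sum>j\<le>m. ?g D (m - j) j)"
      by (subst sum.swap) simp
    moreover have "int (Suc m choose Suc n) = (\<Sum>j\<le>m. int (j choose n))"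
      by (simp only: sum_choose_upper[symmetric] of_nat_sum)
    ultimately show ?thesis by (simp only: sum_distrib_left)
  qed
  \<comment> \<open>The term \<open>i = 0\<close> is lost since \<open>0 choose Suc n\<close> is
    \<open>0\<close>; for \<open>card P = 0\<close> both sums are empty.\<close>
  have "weak_count P r (Suc n) = (\<Sum>m<card P - 1.
      (- 1) ^ (card P + Suc (Suc m)) * ?s P (Suc (Suc m)) * int (Suc m choose Suc n))"
  proof (cases "card P")
    case (Suc c)
    then show ?thesis
      unfolding weak_count_def by (subst Suc, subst sum.lessThan_Suc_shift) simp
  qed (simp add: weak_count_def)
  also have "\<dots> = (\<Sum>D\<in>ideals P r. \<Sum>m<card P - 1. \<Sum>j\<le>m. ?g D (m - j) j)"
    unfolding summand by (rule sum.swap)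
  also have "\<dots> = (\<Sum>D\<in>ideals P r. weak_count D r 0 * weak_count (P - D) r n)"
  proof (rule sum.cong[OF refl])
    fix D assume "D \<in> ideals P r"
    then have D: "D \<subseteq> P" "finite D" "finite (P - D)"
      using assms by (auto simp: down_sets_def intro: finite_subset)
    have card: "card P = card D + card (P - D)"
      using D assms by (metis card_Diff_subset card_mono le_add_diff_inverse)
    have "(\<Sum>m<card P - 1. \<Sum>j\<le>m. ?g D (m - j) j) =
        (\<Sum>(j, k)\<in>{(j, k). j + k < card P - 1}. ?g D k j)"
      by (rule sum.triangle_reindex[symmetric])
    \<comment> \<open>The rectangle fits in the triangle because the sizes of \<open>D\<close> and
      \<open>P - D\<close> add up to \<open>card P\<close>; outside it one of the two parts has
      fewer points than levels.\<close>
    also have "\<dots> = (\<Sum>(j, k)\<in>{..<card (P - D)} \<times> {..<card D}. ?g D k j)"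
    proof (rule sum.mono_neutral_right)
      show "finite {(j, k). j + k < card P - 1}"
        by (rule finite_subset[of _ "{..<card P} \<times> {..<card P}"]) auto
      show "{..<card (P - D)} \<times> {..<card D} \<subseteq> {(j, k). j + k < card P - 1}"
        using card by auto
      show "\<forall>t\<in>{(j, k). j + k < card P - 1} - {..<card (P - D)} \<times> {..<card D}.
          (case t of (j, k) \<Rightarrow> ?g D k j) = 0"
      proof
        fix t assume t: "t \<in> {(j, k). j + k < card P - 1} - {..<card (P - D)} \<times> {..<card D}"
        obtain j k where jk: "t = (j, k)" by (cases t)
        with t have "card (P - D) < Suc j \<or> card D < Suc k" by auto
        then show "(case t of (j, k) \<Rightarrow> ?g D k j) = 0"
          using jk strict_onto_eq_empty[OF D(2), of "Suc k" r]
            strict_onto_eq_empty[OF D(3), of "Suc j" r]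
          by auto
      qed
    qed
    also have "\<dots> = weak_count D r 0 * weak_count (P - D) r n"
      unfolding weak_count_def sum_product
      by (subst sum.cartesian_product[symmetric], subst sum.swap) simp
    finally show "(\<Sum>m<card P - 1. \<Sum>j\<le>m. ?g D (m - j) j) =
        weak_count D r 0 * weak_count (P - D) r n" .
  qed
  finally show ?thesis .
qed

section \<open>Identifying \<open>weak_count\<close> with the number of weak surjections\<close>

lemma card_weak_onto_singleton:
  "card (monotone_onto P Q (\<le>) {a :: nat}) = of_bool (P \<noteq> {})"
proof (cases "P = {}")
  case False
  have "monotone_onto P Q (\<le>) {a} \<subseteq> {\<lambda>x\<in>P. a}"
  proof
    fix f assume "f \<in> monotone_onto P Q (\<le>) {a}"
    then have "f \<in> extensional P" "\<And>x. x \<in> P \<Longrightarrow> f x \<in> {a}"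
      unfolding monotone_onto_def by blast+
    then show "f \<in> {\<lambda>x\<in>P. a}" by (auto simp: fun_eq_iff extensional_def)
  qed
  moreover have "(\<lambda>x\<in>P. a) \<in> monotone_onto P Q (\<le>) {a}"
    using False by (auto simp: monotone_onto_def monotone_on_def)
  ultimately have "monotone_onto P Q (\<le>) {a} = {\<lambda>x\<in>P. a}" by blast
  with False show ?thesis by simp
qed (simp add: monotone_onto_def)

text \<open>Splitting off the fibre over \<open>Min S\<close> gives the recursion of
  \<open>weak_count_Suc\<close>. The codomain is an arbitrary finite set so that the induction
  hypothesis applies to \<open>S - {Min S}\<close>.\<close>

lemma card_weak_onto:
  fixes S :: "nat set"
  assumes "finite P" "trans r" "antisym r" "finite S" "card S = Suc n"
  shows "int (card (monotone_onto P (\<lambda>x y. (x, y) \<in> r) (\<le>) S)) = weak_count P r n"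
  using assms(1,4,5)
proof (induction n arbitrary: P S)
  case 0
  then obtain a where "S = {a}" by (auto simp: card_1_singleton_iff)
  with 0 show ?case by (simp add: card_weak_onto_singleton weak_count_0 assms(2,3))
next
  case (Suc n)
  let ?Q = "\<lambda>x y. (x, y) \<in> r"
  let ?a = "Min S"
  have "?a \<in> S" using Suc.prems by (intro Min_in) auto
  then have S: "S = {?a} \<union> (S - {?a})" by auto
  have "card (monotone_onto P ?Q (\<le>) ({?a} \<union> (S - {?a}))) = (\<Sum>D\<in>ideals P r.
      card (monotone_onto D ?Q (\<le>) {?a}) * card (monotone_onto (P - D) ?Q (\<le>) (S - {?a})))"
  proof (rule card_monotone_onto_Un)
    fix a b assume "a \<in> {?a}" "b \<in> S - {?a}"
    then show "a \<le> b \<and> \<not> b \<le> a" using Min_le[OF Suc.prems(2), of b] by auto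
  qed fact
  also have "int \<dots> = (\<Sum>D\<in>ideals P r. weak_count D r 0 * weak_count (P - D) r n)"
    unfolding of_nat_sum of_nat_mult
  proof (rule sum.cong[OF refl])
    fix D assume "D \<in> ideals P r"
    then have "finite D" using Suc.prems(1) by (auto simp: down_sets_def intro: finite_subset)
    moreover have "int (card (monotone_onto (P - D) ?Q (\<le>) (S - {?a}))) = weak_count (P - D) r n"
      using Suc.prems \<open>?a \<in> S\<close> by (intro Suc.IH) auto
    ultimately show "int (card (monotone_onto D ?Q (\<le>) {?a})) *
        int (card (monotone_onto (P - D) ?Q (\<le>) (S - {?a}))) =
        weak_count D r 0 * weak_count (P - D) r n"
      by (simp add: card_weak_onto_singleton weak_count_0 assms(2,3))
  qed
  finally show ?case using S weak_count_Suc[OF Suc.prems(1)] by simp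
qed

lemma weak_surj_homs_eq: "weak_surj_homs P r n = monotone_onto P (\<lambda>x y. (x, y) \<in> r) (\<le>) {1..n}"
  by (auto simp: weak_surj_homs_def monotone_onto_def PiE_def Pi_def)

section \<open>The series\<close>

text \<open>A strict map is a strict surjection onto its image, so these counts are coefficients in
  the binomial basis; uniqueness of the coefficients does the rest.\<close>

lemma order_coeff_eq:
  assumes "finite P" "P \<noteq> {}" "i \<in> {1..card P}"
  shows "order_coeff P r i = int (card (strict_onto P r {..<i}))"
proof -
  \<comment> \<open>The default \<open>0\<close> matches the normalisation built into
    \<open>order_coeff\<close>.\<close>
  let ?d = "\<lambda>i. if i \<in> {1..card P} then int (card (strict_onto P r {..<i})) else 0"
  obtain p :: "rat poly" where p: "\<And>x. poly p x =
      (\<Sum>i = 1..card P. of_int (?d i) * (x gchoose i))"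
    using poly_gbinomial_sum[where A = "{1..card P}" and c = "\<lambda>i. of_int (?d i)"] by blast
  have "strict_order_poly P r = p"
    by (rule poly_eq_of_nat)
      (simp add: poly_strict_order_poly[OF assms(1,2)] p card_strict_homs[OF assms(1,2)]
        binomial_gbinomial)
  with p have "order_coeff P r = ?d"
    unfolding order_coeff_def by (intro the1_equality[OF ex1_order_coeff[OF assms(1,2)]]) simp
  with assms(3) show ?thesis by simp
qed

lemma fps_nth_one_minus_X_power:
  "((1 - fps_X :: 'a :: comm_ring_1 fps) ^ k) $ n = (- 1) ^ n * of_nat (k choose n)"
proof (induction k arbitrary: n)
  case 0
  then show ?case by (cases n) auto
next
  case (Suc k)
  then show ?case by (cases n) (auto simp: algebra_simps)
qed

lemma weak_surj_series_nth:
  assumes "finite P" "P \<noteq> {}"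
  shows "weak_surj_series P r $ Suc n = (- 1) ^ n * weak_count P r n"
proof -
  have "weak_surj_series P r $ Suc n = (\<Sum>i = 1..card P.
      (- 1) ^ (card P - i) * order_coeff P r i * ((- 1) ^ n * int (i - 1 choose n)))"
    by (simp add: weak_surj_series_def fps_sum_nth fps_nth_one_minus_X_power)
  \<comment> \<open>For \<open>i\<close> at most \<open>card P\<close>, the truncated difference
    \<open>card P - i\<close> has the parity of \<open>card P + i\<close>.\<close>
  also have "\<dots> = (\<Sum>i = 1..card P. (- 1) ^ n * ((- 1) ^ (card P + i) *
      int (card (strict_onto P r {..<i})) * int (i - 1 choose n)))"
    using assms by (intro sum.cong) (auto simp: order_coeff_eq minus_one_power_iff)
  also have "\<dots> = (- 1) ^ n * weak_count P r n"
    unfolding weak_count_def sum_distrib_left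
    by (rule sum.reindex_bij_witness[of _ Suc "\<lambda>i. i - 1"]) auto
  finally show ?thesis .
qed

theorem lemma3p8:
  fixes P :: "'a set" and r :: "'a rel"
  assumes "finite P" and "P \<noteq> {}" and "partial_order_on P r"
  shows "(\<lambda>n. fps_const ((-1) ^ (Suc n + 1) * int (card (weak_surj_homs P r (Suc n)))) * fps_X ^ Suc n)
           sums weak_surj_series P r"
proof -
  let ?Z = "weak_surj_series P r"
  have r: "trans r" "antisym r"
    using assms(3) by (auto simp: partial_order_on_def preorder_on_def)
  have "?Z $ Suc n = (-1) ^ (Suc n + 1) * int (card (weak_surj_homs P r (Suc n)))" for n
    using assms r by (simp add: weak_surj_series_nth weak_surj_homs_eq card_weak_onto)
  \<comment> \<open>With no constant term, the partial sums indexed from \<open>Suc 0\<close> are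
    the truncations of \<open>?Z\<close>, which converge to it by
    \<open>fps_notation\<close>.\<close>
  moreover have "?Z $ 0 = 0" by (simp add: weak_surj_series_def fps_sum_nth)
  then have "(\<Sum>i<n. fps_const (?Z $ Suc i) * fps_X ^ Suc i) =
      (\<Sum>i = 0..n. fps_const (?Z $ i) * fps_X ^ i)" for n
    by (simp add: atLeast0AtMost sum.atMost_shift)
  ultimately show ?thesis
    using fps_notation[of ?Z] by (simp add: sums_def)
qed

end
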